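(* Let $G$ be a Carnot group of step $3$ or higher, identified with $\mathbb{R}^n$ via exponential coordinates of the first kind associated with a basis of its Lie algebra adapted to the stratification, and let $d$ be a homogeneous distance on $G$ whose unit ball centered at the origin, $B_d(0,1)=\{q\in G:\ d(q,0)\leq1\}$, is a Euclidean ball of $\mathbb{R}^n$ centered at the origin. Then the Besicovitch Covering Property does not hold in $(G,d)$.
   Context: A ball in a metric space $(X,d)$ is a set of the form $B_d(p,r):=\{q\in X:\ d(q,p)\leq r\}$ with $p\in X$, $r>0$. Besicovitch Covering Property (BCP): $(X,d)$ satisfies BCP if there exists $N\in\mathbb{N}$ such that the following holds: whenever $A$ is a bounded subset of $X$ and $\mathcal{B}$ is a family of balls such that each point of $A$ is the center of some ball of $\mathcal{B}$, there is a finite or countable subfamily $\mathcal{F}\subset\mathcal{B}$ such that the balls in $\mathcal{F}$ cover $A$ and every point of $X$ belongs to at most $N$ balls of $\mathcal{F}$. Carnot groups: a Carnot group $G$ of step $s\geq1$ is a connected and simply connected Lie group whose Lie algebra $\mathfrak g$ is endowed with a stratification $\mathfrak g=V_1\oplus\cdots\oplus V_s$ with $[V_1,V_j]=V_{j+1}$ for $1\leq j\leq s-1$ and $[V_1,V_s]=\{0\}$ (a Carnot group of step $s$ has exactly $s$ nontrivial layers). Let $n=\dim\mathfrak g$. A basis $(X_1,\dots,X_n)$ of $\mathfrak g$ is adapted to the stratification if $(X_{m_{j-1}+1},\dots,X_{m_j})$ is a basis of $V_j$ for $1\leq j\leq s$, where $m_0=0$ and $m_j-m_{j-1}=\dim V_j$.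 The group $G$ is identified with $\mathbb{R}^n$ by identifying $\exp(x_1X_1+\cdots+x_nX_n)$ with $(x_1,\dots,x_n)$; the group law $\cdot$ is the corresponding one, with identity $0$. Dilations are $\delta_\lambda(x_1,\dots,x_n)=(\lambda^{\alpha_1}x_1,\dots,\lambda^{\alpha_n}x_n)$, $\lambda>0$, where $\alpha_i=j$ for $m_{j-1}+1\leq i\leq m_j$. A distance $d$ on $G$ (satisfying the usual triangle inequality) is homogeneous if it is left-invariant ($d(p\cdot q,p\cdot q')=d(q,q')$ for all $p,q,q'\in G$) and $d(\delta_\lambda(p),\delta_\lambda(q))=\lambda\, d(p,q)$ for all $p,q\in G$, $\lambda>0$. *)

theory Defs
  imports "HOL-Analysis.Analysis"
begin

section \<open>Balls and the Besicovitch covering property\<close>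

context Metric_space
begin

text \<open>A family of balls is a set of subsets of the space: two balls with different centres or
  radii that coincide as sets count once.\<close>

definition BCP :: bool where
  "BCP \<longleftrightarrow>
    (\<exists>N::nat. \<forall>A \<B>.
        mbounded A \<and> \<B> \<subseteq> {mcball p r | p r. p \<in> M \<and> 0 < r} \<and>
        (\<forall>a\<in>A. \<exists>r>0. mcball a r \<in> \<B>) \<longrightarrow>
        (\<exists>\<F>. \<F> \<subseteq> \<B> \<and> countable \<F> \<and> A \<subseteq> \<Union>\<F> \<and>
             (\<forall>x\<in>M. finite {B \<in> \<F>. x \<in> B} \<and> card {B \<in> \<F>. x \<in> B} \<le> N)))"

end

section \<open>Lie groups carried by a Euclidean space\<close>

primrec C_k :: "nat \<Rightarrow> ('a::euclidean_space \<Rightarrow> 'b::real_normed_vector) \<Rightarrow> bool" where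
  "C_k 0 f \<longleftrightarrow> continuous_on UNIV f"
| "C_k (Suc k) f \<longleftrightarrow>
     (\<forall>x. f differentiable (at x)) \<and> (\<forall>v. C_k k (\<lambda>x. frechet_derivative f (at x) v))"

definition smooth :: "('a::euclidean_space \<Rightarrow> 'b::real_normed_vector) \<Rightarrow> bool" where
  "smooth f \<longleftrightarrow> (\<forall>k. C_k k f)"

text \<open>The manifold is the whole space \<open>'a\<close> with its standard smooth structure, so it is connected
  and simply connected, and its tangent space at the identity \<open>0\<close> is \<open>'a\<close> itself.\<close>

definition lie_group :: "('a::euclidean_space \<Rightarrow> 'a \<Rightarrow> 'a) \<Rightarrow> ('a \<Rightarrow> 'a) \<Rightarrow> bool" where
  "lie_group mul iv \<longleftrightarrow>
     group mul 0 iv \<and> smooth (\<lambda>(x, y). mul x y) \<and> smooth iv"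

definition left_invariant_field ::
    "('a::euclidean_space \<Rightarrow> 'a \<Rightarrow> 'a) \<Rightarrow> 'a \<Rightarrow> 'a \<Rightarrow> 'a" where
  "left_invariant_field mul a p = frechet_derivative (mul p) (at 0) a"

definition field_bracket ::
    "('a::euclidean_space \<Rightarrow> 'a) \<Rightarrow> ('a \<Rightarrow> 'a) \<Rightarrow> 'a \<Rightarrow> 'a" where
  "field_bracket X Y p = frechet_derivative Y (at p) (X p) - frechet_derivative X (at p) (Y p)"

text \<open>The Lie algebra is realised on the tangent space at \<open>0\<close>, a vector \<open>a\<close> standing for the
  left-invariant vector field with value \<open>a\<close> at \<open>0\<close>.\<close>

definition lie_bracket :: "('a::euclidean_space \<Rightarrow> 'a \<Rightarrow> 'a) \<Rightarrow> 'a \<Rightarrow> 'a \<Rightarrow> 'a" where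
  "lie_bracket mul a b =
     field_bracket (left_invariant_field mul a) (left_invariant_field mul b) 0"

definition one_parameter_subgroup ::
    "('a::euclidean_space \<Rightarrow> 'a \<Rightarrow> 'a) \<Rightarrow> 'a \<Rightarrow> (real \<Rightarrow> 'a) \<Rightarrow> bool" where
  "one_parameter_subgroup mul a \<gamma> \<longleftrightarrow>
     smooth \<gamma> \<and> (\<forall>s t. \<gamma> (s + t) = mul (\<gamma> s) (\<gamma> t)) \<and> (\<gamma> has_vector_derivative a) (at 0)"

text \<open>The relation \<open>exp a = g\<close>; there is exactly one one-parameter subgroup with a given initial
  velocity.\<close>

definition lie_exp :: "('a::euclidean_space \<Rightarrow> 'a \<Rightarrow> 'a) \<Rightarrow> 'a \<Rightarrow> 'a \<Rightarrow> bool" where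
  "lie_exp mul a g \<longleftrightarrow> (\<exists>\<gamma>. one_parameter_subgroup mul a \<gamma> \<and> \<gamma> 1 = g)"

section \<open>Carnot groups in exponential coordinates of the first kind\<close>

definition direct_sum_decomposition ::
    "nat \<Rightarrow> (nat \<Rightarrow> 'a::real_vector set) \<Rightarrow> bool" where
  "direct_sum_decomposition s V \<longleftrightarrow>
     (\<forall>j\<in>{1..s}. subspace (V j)) \<and>
     span (\<Union>j\<in>{1..s}. V j) = UNIV \<and>
     (\<forall>v. (\<forall>j\<in>{1..s}. v j \<in> V j) \<and> (\<Sum>j=1..s. v j) = 0 \<longrightarrow> (\<forall>j\<in>{1..s}. v j = 0))"

definition bracket_span ::
    "('a::real_vector \<Rightarrow> 'a \<Rightarrow> 'a) \<Rightarrow> 'a set \<Rightarrow> 'a set \<Rightarrow> 'a set" where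
  "bracket_span br U W = span {br u w | u w. u \<in> U \<and> w \<in> W}"

definition stratification ::
    "('a::real_vector \<Rightarrow> 'a \<Rightarrow> 'a) \<Rightarrow> nat \<Rightarrow> (nat \<Rightarrow> 'a set) \<Rightarrow> bool" where
  "stratification br s V \<longleftrightarrow>
     direct_sum_decomposition s V \<and>
     (\<forall>j\<in>{1..s}. V j \<noteq> {0}) \<and>
     (\<forall>j. 1 \<le> j \<and> j < s \<longrightarrow> bracket_span br (V 1) (V j) = V (j + 1)) \<and>
     bracket_span br (V 1) (V s) = {0}"

definition carnot_group ::
    "('a::euclidean_space \<Rightarrow> 'a \<Rightarrow> 'a) \<Rightarrow> ('a \<Rightarrow> 'a) \<Rightarrow> nat \<Rightarrow> (nat \<Rightarrow> 'a set) \<Rightarrow> bool" where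
  "carnot_group mul iv s V \<longleftrightarrow>
     lie_group mul iv \<and> 1 \<le> s \<and> stratification (lie_bracket mul) s V"

text \<open>The basis is indexed by a finite linear order, and \<open>\<alpha> i\<close> is the number of the layer
  containing \<open>X i\<close>. Monotonicity of \<open>\<alpha>\<close> says that the layers occupy consecutive blocks of
  indices, in increasing order.\<close>

definition adapted_basis ::
    "nat \<Rightarrow> (nat \<Rightarrow> 'a::real_vector set) \<Rightarrow> ('n::{finite,linorder} \<Rightarrow> 'a) \<Rightarrow> ('n \<Rightarrow> nat) \<Rightarrow> bool"
  where
  "adapted_basis s V X \<alpha> \<longleftrightarrow>
     mono \<alpha> \<and> range \<alpha> \<subseteq> {1..s} \<and>
     (\<forall>j\<in>{1..s}. inj_on X {i. \<alpha> i = j} \<and> independent (X ` {i. \<alpha> i = j}) \<and>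
                 span (X ` {i. \<alpha> i = j}) = V j)"

definition exponential_coordinates ::
    "(real^'n \<Rightarrow> real^'n \<Rightarrow> real^'n) \<Rightarrow> ('n::finite \<Rightarrow> real^'n) \<Rightarrow> bool" where
  "exponential_coordinates mul X \<longleftrightarrow> (\<forall>x. lie_exp mul (\<Sum>i\<in>UNIV. (x $ i) *\<^sub>R X i) x)"

definition dilation :: "('n::finite \<Rightarrow> nat) \<Rightarrow> real \<Rightarrow> real^'n \<Rightarrow> real^'n" where
  "dilation \<alpha> t x = (\<chi> i. t ^ \<alpha> i * x $ i)"

definition homogeneous_distance ::
    "(real^'n \<Rightarrow> real^'n \<Rightarrow> real^'n) \<Rightarrow> ('n::finite \<Rightarrow> nat) \<Rightarrow> (real^'n \<Rightarrow> real^'n \<Rightarrow> real) \<Rightarrow> bool"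
  where
  "homogeneous_distance mul \<alpha> d \<longleftrightarrow>
     Metric_space UNIV d \<and>
     (\<forall>p q q'. d (mul p q) (mul p q') = d q q') \<and>
     (\<forall>p q t. 0 < t \<longrightarrow> d (dilation \<alpha> t p) (dilation \<alpha> t q) = t * d p q)"

end

theory Submission
  imports Defs
begin

text \<open>BCP fails as soon as there is a sequence of balls with a common point none of which contains
  the centre of another. We find a point \<open>x\<close> with \<open>d x 0 \<le> r\<close> and \<open>d x (dilation \<alpha> \<mu> x) > r\<close> for
  all small \<open>\<mu> > 0\<close>; then the balls with centres \<open>dilation \<alpha> (l ^ i) x\<close> and radii \<open>l ^ i * r\<close> form
  such a sequence if \<open>l\<close> is small. Put \<open>y = - x\<close>, the inverse of \<open>x\<close>. If the rescaled point
  \<open>dilation \<alpha> (1 / r) y\<close> lies on the Euclidean sphere of radius \<open>R\<close>, it suffices that the curve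
  \<open>mul y (dilation \<alpha> \<mu> x)\<close> leaves the ellipsoid \<open>{p. d p 0 \<le> r}\<close> to first order at \<open>\<mu> = 0\<close>. Its
  velocity there is \<open>- L y\<close>, where \<open>L\<close> is the left-invariant field of the first-layer part of \<open>y\<close>.

  Choose \<open>u\<close> and \<open>v\<close> in the first and second layer with \<open>[u, v] \<noteq> 0\<close>, set \<open>w = [u, v] / 2\<close> and let
  \<open>y\<close> be the dilation by \<open>r\<close> of a multiple of \<open>r\<^sup>2 u + v + w\<close>. To first order the left-invariant
  field of \<open>u\<close> at \<open>p\<close> is \<open>u - [u, p] / 2\<close>, and for small \<open>r\<close> the rescaling by \<open>dilation \<alpha> (1 / r)\<close>
  makes the third-layer term \<open>- w \<bullet> [u, v] / 2 < 0\<close> dominate the scalar product of \<open>y\<close> with that field.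
  Hence neither the full Baker-Campbell-Hausdorff formula nor the fact that dilations are
  automorphisms is needed.\<close>

section \<open>Separated balls and the covering property\<close>

lemma (in Metric_space) not_BCP_if_separated_sequence:
  assumes "c \<in> M" "\<And>i::nat. p i \<in> M" "\<And>i. 0 < r i"
    and centre: "\<And>i. d (p i) c \<le> r i"
    and sep: "\<And>i j. i \<noteq> j \<Longrightarrow> r i < d (p i) (p j)"
  shows "\<not> BCP"
proof
  assume BCP
  then obtain N where N: "\<forall>A \<B>.
        mbounded A \<and> \<B> \<subseteq> {mcball p r | p r. p \<in> M \<and> 0 < r} \<and>
        (\<forall>a\<in>A. \<exists>r>0. mcball a r \<in> \<B>) \<longrightarrow>
        (\<exists>\<F>. \<F> \<subseteq> \<B> \<and> countable \<F> \<and> A \<subseteq> \<Union>\<F> \<and>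
             (\<forall>x\<in>M. finite {B \<in> \<F>. x \<in> B} \<and> card {B \<in> \<F>. x \<in> B} \<le> N))"
    unfolding BCP_def by (rule exE)
  define B where "B = (\<lambda>i. mcball (p i) (r i))"
  \<comment> \<open>By \<open>sep\<close> a centre lies in its own ball only, so the balls are
    pairwise distinct as sets.\<close>
  have mem: "p j \<in> B i \<longleftrightarrow> i = j" for i j
  proof (cases "i = j")
    case False
    then show ?thesis
      using sep[of i j] by (auto simp: B_def)
  qed (use assms(2,3) in \<open>auto simp: B_def less_imp_le\<close>)
  have inj: "inj B"
    by (rule injI) (metis mem)
  have "mbounded (\<Union>i\<in>{..N}. {p i})"
    using assms(2) by (intro mbounded_Union) (auto simp: mbounded_insert)
  then have bd: "mbounded (p ` {..N})"
    by (simp add: UNION_singleton_eq_range)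
  have sub: "B ` {..N} \<subseteq> {mcball p r | p r. p \<in> M \<and> 0 < r}"
    using assms(2,3) unfolding B_def by blast
  have cov: "\<forall>a\<in>p ` {..N}. \<exists>r>0. mcball a r \<in> B ` {..N}"
    using assms(3) unfolding B_def by blast
  have "\<exists>\<F>. \<F> \<subseteq> B ` {..N} \<and> countable \<F> \<and> p ` {..N} \<subseteq> \<Union>\<F> \<and>
             (\<forall>x\<in>M. finite {B \<in> \<F>. x \<in> B} \<and> card {B \<in> \<F>. x \<in> B} \<le> N)"
    by (rule N[rule_format]) (use bd sub cov in simp)
  then obtain \<F> where F: "\<F> \<subseteq> B ` {..N}" "p ` {..N} \<subseteq> \<Union>\<F>"
    and card: "\<forall>x\<in>M. finite {B \<in> \<F>. x \<in> B} \<and> card {B \<in> \<F>. x \<in> B} \<le> N"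
    by (elim exE conjE)
  \<comment> \<open>No other ball covers \<open>p i\<close>, so the subfamily keeps all indices in
    \<open>{..N}\<close>: these are \<open>N + 1\<close> balls through \<open>c\<close>, one too
    many.\<close>
  have "B i \<in> \<F>" if "i \<le> N" for i
  proof -
    have "p i \<in> \<Union>\<F>"
      using F(2) that by auto
    then obtain j where "B j \<in> \<F>" "p i \<in> B j"
      using F(1) by auto
    then show ?thesis
      using mem by auto
  qed
  then have "\<F> = B ` {..N}"
    using F(1) by auto
  moreover have "c \<in> B i" for i
    using assms(1,2) centre by (auto simp: B_def)
  ultimately have "{B \<in> \<F>. c \<in> B} = B ` {..N}"
    by auto
  then have "card {B \<in> \<F>. c \<in> B} = Suc N"
    using inj by (simp add: card_image inj_on_subset)
  then show False
    using card assms(1) by auto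
qed

section \<open>Calculus on the Lie group\<close>

lemma vector_derivative_chain:
  assumes "(g has_vector_derivative v) (at t)" "(f has_derivative D) (at (g t))"
  shows "((\<lambda>s. f (g s)) has_vector_derivative D v) (at t)"
  using vector_derivative_diff_chain_within[OF assms(1) has_derivative_at_withinI[OF assms(2)]]
  by (simp add: o_def)

lemma has_vector_derivative_line: "((\<lambda>t. t *\<^sub>R a) has_vector_derivative a) (at t)"
  by (auto intro!: derivative_eq_intros)

lemma has_vector_derivative_cubic_curve:
  "((\<lambda>t::real. (t * a) *\<^sub>R u + (t\<^sup>2 * b) *\<^sub>R v + (t ^ 3 * c) *\<^sub>R w)
     has_vector_derivative a *\<^sub>R u) (at 0)"
  unfolding has_vector_derivative_def by (rule derivative_eq_intros refl | simp)+

lemma lie_group_mul_simps: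
  assumes "lie_group mul iv"
  shows "mul 0 x = x" "mul x 0 = x" "mul (mul x y) z = mul x (mul y z)"
    "mul (iv x) x = 0"
proof -
  interpret group mul 0 iv
    using assms by (simp add: lie_group_def)
  show "mul 0 x = x" "mul x 0 = x" "mul (mul x y) z = mul x (mul y z)"
    "mul (iv x) x = 0"
    by (auto simp: assoc)
qed

lemma lie_group_has_derivative_mul:
  assumes "lie_group mul iv"
  shows "((\<lambda>(x, y). mul x y) has_derivative frechet_derivative (\<lambda>(x, y). mul x y) (at z)) (at z)"
proof -
  have "C_k 1 (\<lambda>(x, y). mul x y)"
    using assms by (simp add: lie_group_def smooth_def)
  then show ?thesis
    by (cases z) (simp add: frechet_derivative_works)
qed

lemma lie_group_has_derivative_left:
  assumes "lie_group mul iv"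
  shows "(mul p has_derivative
           (\<lambda>v. frechet_derivative (\<lambda>(x, y). mul x y) (at (p, q)) (0, v))) (at q)"
  using has_derivative_compose[OF has_derivative_Pair[OF has_derivative_const has_derivative_ident]
      lie_group_has_derivative_mul[OF assms]]
  by simp

lemma lie_group_has_derivative_right:
  assumes "lie_group mul iv"
  shows "((\<lambda>x. mul x q) has_derivative
           (\<lambda>v. frechet_derivative (\<lambda>(x, y). mul x y) (at (p, q)) (v, 0))) (at p)"
  using has_derivative_compose[OF has_derivative_Pair[OF has_derivative_ident has_derivative_const]
      lie_group_has_derivative_mul[OF assms]]
  by simp

text \<open>Multiplying by the identity on either side is the identity map, which fixes both partial
  derivatives.\<close>

lemma lie_group_derivative_mul_0:
  assumes "lie_group mul iv"
  shows "frechet_derivative (\<lambda>(x, y). mul x y) (at (0, 0)) (v, w) = v + w"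
proof -
  let ?D = "frechet_derivative (\<lambda>(x, y). mul x y) (at (0, 0))"
  have "mul 0 = (\<lambda>x. x)" "(\<lambda>x. mul x 0) = (\<lambda>x. x)"
    using lie_group_mul_simps[OF assms] by auto
  with lie_group_has_derivative_left[OF assms, of 0 0] lie_group_has_derivative_right[OF assms, of 0 0]
  have "?D (0, w) = w" "?D (v, 0) = v"
    by (metis has_derivative_unique has_derivative_ident)+
  moreover have "?D ((v, 0) + (0, w)) = ?D (v, 0) + ?D (0, w)"
    by (rule linear_add[OF has_derivative_linear[OF lie_group_has_derivative_mul[OF assms]]])
  ultimately show ?thesis
    by simp
qed

section \<open>One-parameter subgroups and exponential coordinates\<close>

text \<open>The quotient \<open>k s = mul (\<eta> (- s)) (\<gamma> s)\<close> has derivative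
  \<open>- a + a = 0\<close> at \<open>0\<close>. The homomorphism property transports this to every
  other time, so \<open>k\<close> is constant.\<close>

lemma one_parameter_subgroup_unique:
  assumes G: "lie_group mul iv"
    and \<gamma>: "\<And>s t. \<gamma> (s + t) = mul (\<gamma> s) (\<gamma> t)"
    and \<gamma>': "(\<gamma> has_vector_derivative a) (at 0)"
    and \<eta>: "\<And>s t. \<eta> (s + t) = mul (\<eta> s) (\<eta> t)"
    and \<eta>': "(\<eta> has_vector_derivative a) (at 0)"
  shows "\<gamma> = \<eta>"
proof -
  note [simp] = lie_group_mul_simps[OF G]
  have cancel: "x = 0" if "mul x x = x" for x
    by (metis that lie_group_mul_simps[OF G])
  have \<gamma>0: "\<gamma> 0 = 0"
    by (rule cancel) (metis \<gamma> add_0)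
  have \<eta>0: "\<eta> 0 = 0"
    by (rule cancel) (metis \<eta> add_0)
  define k where "k = (\<lambda>s. mul (\<eta> (- s)) (\<gamma> s))"
  have k0: "k 0 = 0"
    by (simp add: k_def \<gamma>0 \<eta>0)
  have "(uminus has_vector_derivative (- 1 :: real)) (at 0)"
    by (auto intro!: derivative_eq_intros simp flip: has_real_derivative_iff_has_vector_derivative)
  then have "((\<lambda>s. \<eta> (- s)) has_vector_derivative - a) (at 0)"
    using vector_diff_chain_at[of uminus "-1" 0 \<eta> a] \<eta>' by (simp add: o_def)
  then have "((\<lambda>s. (\<eta> (- s), \<gamma> s)) has_vector_derivative (- a, a)) (at 0)"
    by (intro has_vector_derivative_Pair \<gamma>')
  then have "((\<lambda>s. case (\<eta> (- s), \<gamma> s) of (x, y) \<Rightarrow> mul x y) has_vector_derivative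
      frechet_derivative (\<lambda>(x, y). mul x y) (at (\<eta> (- 0), \<gamma> 0)) (- a, a)) (at 0)"
    by (rule vector_derivative_chain) (rule lie_group_has_derivative_mul[OF G])
  then have k': "(k has_vector_derivative 0) (at 0)"
    by (simp add: k_def \<gamma>0 \<eta>0 lie_group_derivative_mul_0[OF G])
  have "(k has_vector_derivative 0) (at t)" for t
  proof -
    define \<Phi> where "\<Phi> = (\<lambda>x. mul (\<eta> (- t)) (mul x (\<gamma> t)))"
    \<comment> \<open>Time \<open>s\<close> is split as \<open>t + (s - t)\<close> in
      \<open>\<eta>\<close> and as \<open>(s - t) + t\<close> in \<open>\<gamma>\<close>, so the
      increment ends up between two fixed factors.\<close>
    have k_eq: "k s = \<Phi> (k (s - t))" for s
    proof -
      have "k s = mul (\<eta> (- t + - (s - t))) (\<gamma> (s - t + t))"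
        by (simp add: k_def)
      also have "\<dots> = \<Phi> (k (s - t))"
        by (simp only: \<gamma> \<eta>) (simp add: \<Phi>_def k_def)
      finally show ?thesis .
    qed
    obtain D where D: "(\<Phi> has_derivative D) (at (k (t - t)))"
      unfolding \<Phi>_def
      using has_derivative_compose[OF lie_group_has_derivative_right[OF G] lie_group_has_derivative_left[OF G]]
      by blast
    have "((\<lambda>s. s - t) has_vector_derivative 1) (at t)"
      by (auto intro!: derivative_eq_intros)
    moreover have "(k has_vector_derivative 0) (at (t - t))"
      using k' by simp
    ultimately have "(k \<circ> (\<lambda>s. s - t) has_vector_derivative 1 *\<^sub>R 0) (at t)"
      by (rule vector_diff_chain_at)
    then have "((\<lambda>s. k (s - t)) has_vector_derivative 0) (at t)"
      by (simp add: o_def)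
    from vector_derivative_chain[OF this D]
    have "((\<lambda>s. \<Phi> (k (s - t))) has_vector_derivative D 0) (at t)" .
    moreover have "D 0 = 0"
      using D by (simp add: has_derivative_linear linear_0)
    ultimately show ?thesis
      by (simp flip: k_eq)
  qed
  then have "k t = k 0" for t
    using has_vector_derivative_zero_constant[of UNIV k]
    by (metis UNIV_I convex_UNIV)
  then have "mul (\<eta> (- t)) (\<gamma> t) = 0" for t
    using k0 by (simp add: k_def)
  moreover have "mul (\<eta> t) (\<eta> (- t)) = 0" for t
    using \<eta>[of t "- t"] \<eta>0 by simp
  ultimately have "\<gamma> t = \<eta> t" for t
    by (metis lie_group_mul_simps(1,2,3)[OF G])
  then show ?thesis
    by auto
qed

text \<open>For each \<open>t\<close> the hypothesis gives a separate subgroup with velocity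
  \<open>t *\<^sub>R a\<close>, located only at time 1. Uniqueness identifies it with a time-scaled
  copy of the subgroup of \<open>a\<close>, which is therefore the line through \<open>x\<close>;
  comparing velocities gives \<open>a = x\<close>.\<close>

lemma
  assumes G: "lie_group mul iv" and exp: "exponential_coordinates mul X"
  shows exponential_coordinates_basis: "(\<Sum>i\<in>UNIV. (x $ i) *\<^sub>R X i) = x"
    and exponential_coordinates_mul_line: "mul (s *\<^sub>R x) (t *\<^sub>R x) = (s + t) *\<^sub>R x"
proof -
  define a where "a = (\<Sum>i\<in>UNIV. (x $ i) *\<^sub>R X i)"
  have "lie_exp mul (t *\<^sub>R a) (t *\<^sub>R x)" for t
    using exp[unfolded exponential_coordinates_def, rule_format, of "t *\<^sub>R x"]
    by (simp add: a_def scaleR_sum_right)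
  then have "\<forall>t. \<exists>\<eta>. one_parameter_subgroup mul (t *\<^sub>R a) \<eta> \<and> \<eta> 1 = t *\<^sub>R x"
    by (simp add: lie_exp_def)
  then obtain \<eta> where "\<And>t. one_parameter_subgroup mul (t *\<^sub>R a) (\<eta> t)"
    and \<eta>1: "\<And>t. \<eta> t 1 = t *\<^sub>R x"
    by metis
  then have \<eta>: "\<eta> t (u + v) = mul (\<eta> t u) (\<eta> t v)"
    and \<eta>': "(\<eta> t has_vector_derivative t *\<^sub>R a) (at 0)" for t u v
    unfolding one_parameter_subgroup_def by blast+
  have \<eta>_line: "\<eta> 1 t = t *\<^sub>R x" for t
  proof -
    have "((\<lambda>s. s * t) has_vector_derivative t) (at 0)"
      by (auto intro!: derivative_eq_intros simp: has_real_derivative_iff_has_vector_derivative[symmetric])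
    moreover have "(\<eta> 1 has_vector_derivative a) (at (0 * t))"
      using \<eta>'[of 1] by simp
    ultimately have "((\<lambda>s. \<eta> 1 (s * t)) has_vector_derivative t *\<^sub>R a) (at 0)"
      using vector_diff_chain_at[of "\<lambda>s. s * t" t 0 "\<eta> 1" a] by (simp add: o_def)
    then have "(\<lambda>s. \<eta> 1 (s * t)) = \<eta> t"
      by (intro one_parameter_subgroup_unique[OF G _ _ \<eta> \<eta>']) (simp_all add: distrib_right \<eta>)
    from fun_cong[OF this, of 1] show ?thesis
      using \<eta>1[of t] by simp
  qed
  show "mul (s *\<^sub>R x) (t *\<^sub>R x) = (s + t) *\<^sub>R x"
    using \<eta>[of 1 s t] by (simp add: \<eta>_line)
  have "\<eta> 1 = (\<lambda>t. t *\<^sub>R x)"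
    using \<eta>_line by auto
  then have "((\<lambda>t. t *\<^sub>R x) has_vector_derivative a) (at 0)"
    using \<eta>'[of 1] by simp
  moreover have "((\<lambda>t. t *\<^sub>R x) has_vector_derivative x) (at 0)"
    by (auto intro!: derivative_eq_intros)
  ultimately show "(\<Sum>i\<in>UNIV. (x $ i) *\<^sub>R X i) = x"
    unfolding a_def by (rule vector_derivative_unique_at)
qed

lemma exponential_coordinates_mul_minus:
  assumes "lie_group mul iv" "exponential_coordinates mul X"
  shows "mul x (- x) = 0"
  using exponential_coordinates_mul_line[OF assms, of 1 x "-1"] by simp

section \<open>Left-invariant fields and the bracket\<close>

text \<open>As a partial derivative of the jointly smooth multiplication, the field can be
  differentiated in \<open>p\<close>.\<close>

lemma left_invariant_field_eq:
  assumes "lie_group mul iv"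
  shows "left_invariant_field mul a p = frechet_derivative (\<lambda>(x, y). mul x y) (at (p, 0)) (0, a)"
  unfolding left_invariant_field_def
  using frechet_derivative_at[OF lie_group_has_derivative_left[OF assms, of p 0]] by (metis)

lemma left_invariant_field_has_derivative:
  assumes "lie_group mul iv"
  shows "(mul p has_derivative (\<lambda>a. left_invariant_field mul a p)) (at 0)"
  using lie_group_has_derivative_left[OF assms, of p 0]
  by (simp add: left_invariant_field_eq[OF assms])

lemma left_invariant_field_linear:
  assumes "lie_group mul iv"
  shows "linear (\<lambda>a. left_invariant_field mul a p)"
  using left_invariant_field_has_derivative[OF assms] by (rule has_derivative_linear)

lemma left_invariant_field_0:
  assumes "lie_group mul iv"
  shows "left_invariant_field mul a 0 = a"
  by (simp add: left_invariant_field_eq[OF assms] lie_group_derivative_mul_0[OF assms])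

lemma left_invariant_field_differentiable:
  assumes "lie_group mul iv"
  shows "left_invariant_field mul a differentiable (at p)"
proof -
  have "C_k 2 (\<lambda>(x, y). mul x y)"
    using assms by (simp add: lie_group_def smooth_def)
  then have "(\<lambda>z. frechet_derivative (\<lambda>(x, y). mul x y) (at z) (0, a)) differentiable (at (p, 0))"
    by (simp add: numeral_2_eq_2)
  then have "(\<lambda>z. frechet_derivative (\<lambda>(x, y). mul x y) (at z) (0, a)) \<circ> (\<lambda>p. (p, 0))
      differentiable (at p)"
    by (intro differentiable_chain_at) (auto intro!: differentiableI derivative_eq_intros)
  then show ?thesis
    by (simp add: o_def left_invariant_field_eq[OF assms, abs_def])
qed

text \<open>The field of \<open>a\<close> is constant along the line through \<open>a\<close>, so
  its derivative \<open>C a\<close> at \<open>0\<close> kills \<open>a\<close>. Polarisation makes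
  \<open>C\<close> antisymmetric, and the two terms \<open>C b a\<close> and \<open>- C a b\<close>
  of the bracket coincide.\<close>

lemma lie_bracket_exponential_coordinates:
  assumes G: "lie_group mul iv" and exp: "exponential_coordinates mul X"
  shows "lie_bracket mul a b = - 2 *\<^sub>R frechet_derivative (left_invariant_field mul a) (at 0) b"
proof -
  define L where "L = left_invariant_field mul"
  define C where "C a = frechet_derivative (L a) (at 0)" for a
  have C: "(L a has_derivative C a) (at 0)" for a
    using left_invariant_field_differentiable[OF G, of a 0]
    by (simp add: C_def L_def frechet_derivative_works)
  have L_add: "L (a + b) p = L a p + L b p" for a b p
    unfolding L_def by (rule linear_add[OF left_invariant_field_linear[OF G]])
  have L_line: "L a (s *\<^sub>R a) = a" for a s
  proof -
    have "mul (s *\<^sub>R a) (t *\<^sub>R a) = s *\<^sub>R a + t *\<^sub>R a" for t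
      by (simp add: exponential_coordinates_mul_line[OF G exp] scaleR_left_distrib)
    moreover have "((\<lambda>t. mul (s *\<^sub>R a) (t *\<^sub>R a)) has_vector_derivative L a (s *\<^sub>R a)) (at 0)"
      using vector_derivative_chain[OF has_vector_derivative_line, of "mul (s *\<^sub>R a)" _ 0 a]
        left_invariant_field_has_derivative[OF G, of "s *\<^sub>R a"]
      by (simp add: L_def)
    moreover have "((\<lambda>t. s *\<^sub>R a + t *\<^sub>R a) has_vector_derivative a) (at 0)"
      by (auto intro!: derivative_eq_intros)
    ultimately show ?thesis
      by (auto dest: vector_derivative_unique_at)
  qed
  have C_self: "C a a = 0" for a
  proof -
    have "((\<lambda>s. L a (s *\<^sub>R a)) has_vector_derivative C a a) (at 0)"
      using vector_derivative_chain[OF has_vector_derivative_line, of "L a" _ 0 a] C[of a] by simp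
    then have "((\<lambda>s::real. a) has_vector_derivative C a a) (at 0)"
      by (simp add: L_line)
    moreover have "((\<lambda>s::real. a) has_vector_derivative 0) (at 0)"
      by (rule has_vector_derivative_const)
    ultimately show ?thesis
      by (rule vector_derivative_unique_at)
  qed
  have C_add: "C (a + b) h = C a h + C b h" for a b h
  proof -
    have "L (a + b) = (\<lambda>p. L a p + L b p)"
      by (auto simp: L_add)
    then have "(L (a + b) has_derivative (\<lambda>h. C a h + C b h)) (at 0)"
      using C[of a] C[of b] by (auto intro: has_derivative_add)
    with C[of "a + b"] have "C (a + b) = (\<lambda>h. C a h + C b h)"
      by (rule has_derivative_unique)
    then show ?thesis
      by simp
  qed
  have C_add2: "C a (h + k) = C a h + C a k" for a h k
    by (rule linear_add[OF has_derivative_linear[OF C]])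
  have "C a b + C b a = 0"
    using C_self[of "a + b"] unfolding C_add C_add2 by (simp add: C_self add.commute)
  moreover have "lie_bracket mul a b = C b a - C a b"
    by (simp add: lie_bracket_def field_bracket_def C_def L_def[symmetric]
        left_invariant_field_0[OF G, folded L_def])
  ultimately show ?thesis
    by (simp add: C_def L_def scaleR_2 eq_neg_iff_add_eq_0 add.commute)
qed

section \<open>Layers and dilations\<close>

text \<open>Exponential coordinates force \<open>X\<close> to be the standard basis, so every layer
  is a coordinate subspace.\<close>

lemma adapted_basis_layer_support:
  fixes v :: "real^'n::{finite,linorder}"
  assumes "lie_group mul iv" "exponential_coordinates mul X" and ab: "adapted_basis s V X \<alpha>"
    and j: "j \<in> {1..s}" and v: "v \<in> V j" and i: "\<alpha> i \<noteq> j"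
  shows "v $ i = 0"
proof -
  have X: "X k = axis k 1" for k
  proof -
    have "axis k 1 = (\<Sum>i\<in>UNIV. (axis k (1::real) $ i) *\<^sub>R X i)"
      using exponential_coordinates_basis[OF assms(1,2)] by metis
    also have "\<dots> = (\<Sum>i\<in>UNIV. if k = i then X i else 0)"
      by (rule sum.cong) (auto simp: axis_def)
    finally show ?thesis
      by simp
  qed
  have "span (X ` {i. \<alpha> i = j}) \<subseteq> {v. v $ i = 0}"
    using i by (intro span_minimal) (auto simp: X axis_def subspace_def)
  then show ?thesis
    using ab j v unfolding adapted_basis_def by blast
qed

lemma dilation_dilation: "dilation \<alpha> s (dilation \<alpha> t x) = dilation \<alpha> (s * t) x"
  by (simp add: dilation_def vec_eq_iff power_mult_distrib)

lemma dilation_zero [simp]: "dilation \<alpha> t 0 = 0"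
  by (simp add: dilation_def vec_eq_iff)

lemma dilation_one [simp]: "dilation \<alpha> 1 x = x"
  by (simp add: dilation_def vec_eq_iff)

lemma not_BCP_if_dilation_curve_escapes:
  assumes hd: "homogeneous_distance mul \<alpha> d"
    and "0 < r" "d x 0 \<le> r" "0 < \<delta>"
    and esc: "\<And>\<mu>. 0 < \<mu> \<Longrightarrow> \<mu> < \<delta> \<Longrightarrow> r < d x (dilation \<alpha> \<mu> x)"
  shows "\<not> Metric_space.BCP UNIV d"
proof -
  interpret Metric_space UNIV d
    using hd by (simp add: homogeneous_distance_def)
  have hom: "d (dilation \<alpha> t p) (dilation \<alpha> t q) = t * d p q" if "0 < t" for t p q
    using hd that by (simp add: homogeneous_distance_def)
  \<comment> \<open>All positive powers of \<open>l\<close> lie below \<open>\<delta>\<close>, so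
    \<open>esc\<close> applies to every gap \<open>j - i\<close>. The radii decrease, so separation
    against the larger radius settles both orders of the indices.\<close>
  define l where "l = min (\<delta> / 2) (1 / 2)"
  have l: "0 < l" "l < \<delta>" "l < 1"
    using assms(4) by (auto simp: l_def)
  define p where "p i = dilation \<alpha> (l ^ i) x" for i :: nat
  have lt: "l ^ i * r < d (p i) (p j)" if "i < j" for i j
  proof -
    have "l ^ (j - i) \<le> l ^ 1"
      using that l by (intro power_decreasing) auto
    then have "r < d x (dilation \<alpha> (l ^ (j - i)) x)"
      using l by (intro esc) auto
    then have "l ^ i * r < l ^ i * d x (dilation \<alpha> (l ^ (j - i)) x)"
      using l by simp
    also have "\<dots> = d (dilation \<alpha> (l ^ i) x) (dilation \<alpha> (l ^ i) (dilation \<alpha> (l ^ (j - i)) x))"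
      using l by (simp add: hom)
    also have "\<dots> = d (p i) (p j)"
      using that by (simp add: p_def dilation_dilation flip: power_add)
    finally show ?thesis .
  qed
  show ?thesis
  proof (rule not_BCP_if_separated_sequence)
    show "d (p i) 0 \<le> l ^ i * r" for i
      using hom[of "l ^ i" x 0] l assms(3) by (simp add: p_def)
    show "l ^ i * r < d (p i) (p j)" if "i \<noteq> j" for i j
    proof (cases "i < j")
      case False
      then have "j < i"
        using that by simp
      have "l ^ i * r \<le> l ^ j * r"
        using \<open>j < i\<close> l assms(2) by (intro mult_right_mono power_decreasing) auto
      with lt[OF \<open>j < i\<close>] show ?thesis
        by (simp add: commute)
    qed (rule lt)
  qed (use l assms(2) in auto)
qed

section \<open>Asymptotics of the rescaled field\<close>

text \<open>First-order expansion along \<open>y\<close>: the relative error \<open>e\<close> tends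
  to 0 while the norm of \<open>y r /\<^sub>R c r\<close> converges.\<close>

lemma has_derivative_tendsto_along:
  fixes f :: "'a::real_normed_vector \<Rightarrow> 'b::real_normed_vector" and c :: "'c \<Rightarrow> real"
  assumes D: "(f has_derivative D) (at 0)"
    and y: "(y \<longlongrightarrow> 0) F" and w: "((\<lambda>r. y r /\<^sub>R c r) \<longlongrightarrow> w) F"
    and c: "\<And>r. 0 \<le> c r"
  shows "((\<lambda>r. (f (y r) - f 0) /\<^sub>R c r) \<longlongrightarrow> D w) F"
proof -
  interpret D: bounded_linear D
    using D by (rule has_derivative_bounded_linear)
  \<comment> \<open>Since \<open>inverse 0 = 0\<close>, also \<open>e 0 = 0\<close>; this makes
    \<open>e\<close> continuous at \<open>0\<close>, and \<open>y\<close> may take the value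
    \<open>0\<close>.\<close>
  define e where "e x = (f x - f 0 - D x) /\<^sub>R norm x" for x
  have "((\<lambda>x. norm (e x)) \<longlongrightarrow> 0) (at 0)"
    using D by (simp add: has_derivative_iff_norm e_def divide_inverse_commute)
  then have "(e \<longlongrightarrow> e 0) (at 0)"
    unfolding tendsto_norm_zero_iff by (simp add: e_def[of 0])
  with y have "((\<lambda>r. e (y r)) \<longlongrightarrow> e 0) F"
    by (intro isCont_tendsto_compose[of 0 e]) (simp_all add: isCont_def)
  with w have "((\<lambda>r. D (y r /\<^sub>R c r) + norm (y r /\<^sub>R c r) *\<^sub>R e (y r)) \<longlongrightarrow> D w + norm w *\<^sub>R e 0) F"
    by (intro tendsto_intros D.tendsto)
  moreover have "(f (y r) - f 0) /\<^sub>R c r = D (y r /\<^sub>R c r) + norm (y r /\<^sub>R c r) *\<^sub>R e (y r)" for r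
  proof -
    have "f x - f 0 = D x + norm x *\<^sub>R e x" for x
      by (cases "x = 0") (simp_all add: e_def D.zero)
    then show ?thesis
      using c[of r] by (simp add: D.scaleR scaleR_add_right)
  qed
  ultimately show ?thesis
    by (simp add: e_def)
qed

lemma dilation_layers:
  assumes "\<And>i. \<alpha> i \<noteq> 1 \<Longrightarrow> u $ i = 0" "\<And>i. \<alpha> i \<noteq> 2 \<Longrightarrow> v $ i = 0" "\<And>i. \<alpha> i \<noteq> 3 \<Longrightarrow> w $ i = 0"
  shows "dilation \<alpha> r (a *\<^sub>R u + b *\<^sub>R v + c *\<^sub>R w)
    = (r * a) *\<^sub>R u + (r\<^sup>2 * b) *\<^sub>R v + (r ^ 3 * c) *\<^sub>R w"
proof -
  have "r ^ \<alpha> i * (a * u $ i + b * v $ i + c * w $ i)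
      = r * a * u $ i + r\<^sup>2 * b * v $ i + r ^ 3 * c * w $ i" for i
    using assms[of i] by (cases "\<alpha> i = 1"; cases "\<alpha> i = 2"; cases "\<alpha> i = 3") auto
  then show ?thesis
    by (simp add: dilation_def vec_eq_iff)
qed

text \<open>The sum is the scalar product of \<open>q r\<close> with the field at
  \<open>dilation \<alpha> r (q r)\<close>, rescaled by \<open>dilation \<alpha> (1 / r)\<close>.
  The field deviates from \<open>u\<close> by about \<open>r\<^sup>2 * \<kappa>0\<close> times
  \<open>C v\<close>. Division by \<open>r ^ 3\<close> in the third layer makes this grow like
  \<open>1 / r\<close>, which the prefactor \<open>r\<close> compensates; the other layers disappear
  in the limit.\<close>

lemma third_layer_dominates:
  fixes L :: "real^'n \<Rightarrow> real^'n" and \<alpha> :: "'n::finite \<Rightarrow> nat"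
  assumes L: "(L has_derivative C) (at 0)" "L 0 = u"
    and u: "\<And>i. \<alpha> i \<noteq> 1 \<Longrightarrow> u $ i = 0"
    and v: "\<And>i. \<alpha> i \<noteq> 2 \<Longrightarrow> v $ i = 0"
    and w: "\<And>i. \<alpha> i \<noteq> 3 \<Longrightarrow> w $ i = 0"
    and \<kappa>: "(\<kappa> \<longlongrightarrow> \<kappa>0) (at_right 0)"
    and q: "\<And>r. q r = \<kappa> r *\<^sub>R (r\<^sup>2 *\<^sub>R u + v + w)"
  shows "((\<lambda>r. r * (\<Sum>i\<in>UNIV. q r $ i * L (dilation \<alpha> r (q r)) $ i / r ^ \<alpha> i))
           \<longlongrightarrow> \<kappa>0\<^sup>2 * (w \<bullet> C v)) (at_right 0)"
proof -
  define y where "y r = dilation \<alpha> r (q r)" for r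
  define E where "E r = (L (y r) - u) /\<^sub>R r\<^sup>2" for r
  interpret C: bounded_linear C
    using L(1) by (rule has_derivative_bounded_linear)
  have [tendsto_intros]: "((\<lambda>r::real. r) \<longlongrightarrow> 0) (at_right 0)"
    by (rule tendsto_ident_at)
  have y_eq: "y r = \<kappa> r *\<^sub>R (r ^ 3 *\<^sub>R u + r\<^sup>2 *\<^sub>R v + r ^ 3 *\<^sub>R w)" for r
    using dilation_layers[of \<alpha> u v w r "\<kappa> r * r\<^sup>2" "\<kappa> r" "\<kappa> r"] u v w
    by (simp add: y_def q scaleR_add_right power3_eq_cube power2_eq_square mult_ac)
  have y0: "(y \<longlongrightarrow> 0) (at_right 0)"
    unfolding y_eq by (rule tendsto_eq_intros \<kappa> refl | simp)+
  \<comment> \<open>The weight \<open>r\<^sup>2\<close> on \<open>u\<close> in \<open>q r\<close>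
    becomes \<open>r ^ 3\<close> after dilation, so only \<open>v\<close> survives at order
    \<open>r\<^sup>2\<close>.\<close>
  have "((\<lambda>r. \<kappa> r *\<^sub>R (r *\<^sub>R u + v + r *\<^sub>R w)) \<longlongrightarrow> \<kappa>0 *\<^sub>R v) (at_right 0)"
    by (rule tendsto_eq_intros \<kappa> refl | simp)+
  moreover have "\<forall>\<^sub>F r in at_right 0. \<kappa> r *\<^sub>R (r *\<^sub>R u + v + r *\<^sub>R w) = y r /\<^sub>R r\<^sup>2"
    by (rule eventually_at_right_less[THEN eventually_mono])
      (simp add: y_eq scaleR_add_right power3_eq_cube power2_eq_square field_simps)
  ultimately have "((\<lambda>r. y r /\<^sub>R r\<^sup>2) \<longlongrightarrow> \<kappa>0 *\<^sub>R v) (at_right 0)"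
    by (rule Lim_transform_eventually)
  from has_derivative_tendsto_along[OF L(1) y0 this]
  have E: "(E \<longlongrightarrow> \<kappa>0 *\<^sub>R C v) (at_right 0)"
    by (simp add: E_def[abs_def] L(2) C.scaleR)
  have Ly: "((\<lambda>r. L (y r)) \<longlongrightarrow> u) (at_right 0)"
    using isCont_tendsto_compose[OF has_derivative_continuous[OF L(1)] y0] L(2) by simp
  have "((\<lambda>r. r * (q r $ i * L (y r) $ i / r ^ \<alpha> i)) \<longlongrightarrow> \<kappa>0\<^sup>2 * (w $ i * C v $ i)) (at_right 0)" for i
  proof -
    \<comment> \<open>The summands belong to layers one, two and three; at most one is nonzero at a
      given index.\<close>
    have "((\<lambda>r. \<kappa> r * r\<^sup>2 * u $ i * L (y r) $ i + \<kappa> r * v $ i * r * E r $ i + \<kappa> r * w $ i * E r $ i)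
        \<longlongrightarrow> \<kappa>0\<^sup>2 * (w $ i * C v $ i)) (at_right 0)"
      by (rule tendsto_eq_intros \<kappa> E Ly refl | simp add: power2_eq_square)+
    moreover have "\<forall>\<^sub>F r in at_right 0.
        \<kappa> r * r\<^sup>2 * u $ i * L (y r) $ i + \<kappa> r * v $ i * r * E r $ i + \<kappa> r * w $ i * E r $ i
        = r * (q r $ i * L (y r) $ i / r ^ \<alpha> i)"
    proof (rule eventually_at_right_less[THEN eventually_mono])
      fix r :: real assume "0 < r"
      then show "\<kappa> r * r\<^sup>2 * u $ i * L (y r) $ i + \<kappa> r * v $ i * r * E r $ i + \<kappa> r * w $ i * E r $ i
        = r * (q r $ i * L (y r) $ i / r ^ \<alpha> i)"
        using u[of i] v[of i] w[of i]
        by (cases "\<alpha> i = 1"; cases "\<alpha> i = 2"; cases "\<alpha> i = 3")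
          (auto simp: q E_def power2_eq_square power3_eq_cube field_simps)
    qed
    ultimately show ?thesis
      by (rule Lim_transform_eventually)
  qed
  then have "((\<lambda>r. \<Sum>i\<in>UNIV. r * (q r $ i * L (y r) $ i / r ^ \<alpha> i))
      \<longlongrightarrow> (\<Sum>i\<in>UNIV. \<kappa>0\<^sup>2 * (w $ i * C v $ i))) (at_right 0)"
    by (intro tendsto_sum)
  then show ?thesis
    by (simp add: y_def inner_vec_def sum_distrib_left)
qed

section \<open>Ellipsoidal balls and nonzero brackets\<close>

lemma homogeneous_distance_le_iff:
  assumes hd: "homogeneous_distance mul \<alpha> d" and ball: "{q. d q 0 \<le> 1} = cball 0 R" and "0 < r"
  shows "d p 0 \<le> r \<longleftrightarrow> norm (dilation \<alpha> (1 / r) p) \<le> R"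
proof -
  have "d p 0 = d (dilation \<alpha> r (dilation \<alpha> (1 / r) p)) (dilation \<alpha> r 0)"
    using \<open>0 < r\<close> by (simp add: dilation_dilation)
  also have "\<dots> = r * d (dilation \<alpha> (1 / r) p) 0"
    using hd \<open>0 < r\<close> unfolding homogeneous_distance_def by blast
  finally have "d p 0 \<le> r \<longleftrightarrow> dilation \<alpha> (1 / r) p \<in> {q. d q 0 \<le> 1}"
    using \<open>0 < r\<close> by simp
  then show ?thesis
    unfolding ball by simp
qed

lemma norm_dilation_power2: "(norm (dilation \<alpha> t x))\<^sup>2 = (\<Sum>i\<in>UNIV. (t ^ \<alpha> i * x $ i)\<^sup>2)"
  unfolding power2_norm_eq_inner by (simp add: dilation_def inner_vec_def power2_eq_square)

text \<open>If all these brackets vanished, so would the next layer, which they span.\<close>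

lemma stratification_bracket_neq_0:
  assumes "stratification br s V" "1 \<le> j" "j < s"
  obtains u v where "u \<in> V 1" "v \<in> V j" "br u v \<in> V (j + 1)" "br u v \<noteq> 0"
proof -
  have span: "span {br u v | u v. u \<in> V 1 \<and> v \<in> V j} = V (j + 1)"
    using assms by (simp add: stratification_def bracket_span_def)
  have "V (j + 1) \<noteq> {0}"
    using assms unfolding stratification_def by simp
  moreover have "V (j + 1) \<subseteq> {0}" if "{br u v | u v. u \<in> V 1 \<and> v \<in> V j} \<subseteq> {0}"
    using span_minimal[OF that] span by simp
  moreover have "0 \<in> V (j + 1)"
    unfolding span[symmetric] by (rule span_zero)
  ultimately have "\<not> {br u v | u v. u \<in> V 1 \<and> v \<in> V j} \<subseteq> {0}"
    by fast
  then obtain u v where "u \<in> V 1" "v \<in> V j" "br u v \<noteq> 0"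
    by auto
  moreover from this have "br u v \<in> V (j + 1)"
    unfolding span[symmetric] by (intro span_base) blast
  ultimately show ?thesis
    using that by blast
qed

section \<open>A boundary point whose dilation curve escapes\<close>

theorem corollary1p7:
  fixes mul :: "real^'n::{finite,linorder} \<Rightarrow> real^'n::{finite,linorder} \<Rightarrow> real^'n::{finite,linorder}"
    and iv :: "real^'n::{finite,linorder} \<Rightarrow> real^'n::{finite,linorder}"
    and s :: nat
    and V :: "nat \<Rightarrow> (real^'n::{finite,linorder}) set"
    and X :: "'n::{finite,linorder} \<Rightarrow> real^'n::{finite,linorder}"
    and \<alpha> :: "'n::{finite,linorder} \<Rightarrow> nat"
    and d :: "real^'n::{finite,linorder} \<Rightarrow> real^'n::{finite,linorder} \<Rightarrow> real"
    and R :: real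
  assumes "carnot_group mul iv s V"
    and "3 \<le> s"
    and "adapted_basis s V X \<alpha>"
    and "exponential_coordinates mul X"
    and "homogeneous_distance mul \<alpha> d"
    and "0 < R"
    and "{q. d q 0 \<le> 1} = cball 0 R"
  shows "\<not> Metric_space.BCP UNIV d"
proof -
  have G: "lie_group mul iv" and strat: "stratification (lie_bracket mul) s V"
    using assms(1) by (auto simp: carnot_group_def)
  note exp = assms(4) and hd = assms(5)
  interpret Metric_space UNIV d
    using hd by (simp add: homogeneous_distance_def)
  define L where "L = left_invariant_field mul"
  obtain u v where "u \<in> V 1" "v \<in> V 2" and br: "lie_bracket mul u v \<in> V 3" "lie_bracket mul u v \<noteq> 0"
    using stratification_bracket_neq_0[OF strat, of 2] assms(2) by auto
  define C where "C = frechet_derivative (L u) (at 0)"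
  \<comment> \<open>This is half the bracket of \<open>u\<close> and \<open>v\<close>; the sign
    gives the leading term \<open>w \<bullet> C v = - (w \<bullet> w)\<close>.\<close>
  define w where "w = - C v"
  have C: "(L u has_derivative C) (at 0)"
    using left_invariant_field_differentiable[OF G, of u 0]
    by (simp add: C_def L_def frechet_derivative_works)
  have w_br: "lie_bracket mul u v = 2 *\<^sub>R w"
    using lie_bracket_exponential_coordinates[OF G exp, of u v] by (simp add: w_def C_def L_def)
  have u: "u $ i = 0" if "\<alpha> i \<noteq> 1" for i
    using adapted_basis_layer_support[OF G exp assms(3) _ \<open>u \<in> V 1\<close> that] assms(2) by simp
  have v: "v $ i = 0" if "\<alpha> i \<noteq> 2" for i
    using adapted_basis_layer_support[OF G exp assms(3) _ \<open>v \<in> V 2\<close> that] assms(2) by simp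
  have w: "w $ i = 0" if "\<alpha> i \<noteq> 3" for i
    using adapted_basis_layer_support[OF G exp assms(3) _ br(1) that] assms(2) by (simp add: w_br)
  have "w \<noteq> 0"
    using br(2) w_br by auto
  then obtain i0 where "w $ i0 \<noteq> 0"
    by (auto simp: vec_eq_iff)
  \<comment> \<open>The index \<open>i0\<close> is in the third layer, where \<open>u\<close> and
    \<open>v\<close> vanish. Hence \<open>\<kappa>\<close> never divides by zero.\<close>
  then have "(t *\<^sub>R u + v + w) $ i0 \<noteq> 0" for t
    using u[of i0] v[of i0] w[of i0] by (cases "\<alpha> i0 = 3") auto
  then have nz: "t *\<^sub>R u + v + w \<noteq> 0" for t
    by (metis zero_index)
  \<comment> \<open>Chosen to put \<open>q r\<close> on the sphere of radius \<open>R\<close>, hence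
    its dilation on the boundary of the ball of radius \<open>r\<close>.\<close>
  define \<kappa> where "\<kappa> r = R / norm (r\<^sup>2 *\<^sub>R u + v + w)" for r
  define q where "q r = \<kappa> r *\<^sub>R (r\<^sup>2 *\<^sub>R u + v + w)" for r
  have "v + w \<noteq> 0"
    using nz[of 0] by simp
  then have "(\<kappa> \<longlongrightarrow> R / norm (v + w)) (at_right 0)"
    unfolding \<kappa>_def by (auto intro!: tendsto_eq_intros)
  from third_layer_dominates[OF C _ u v w this q_def]
  have "((\<lambda>r. r * (\<Sum>i\<in>UNIV. q r $ i * L u (dilation \<alpha> r (q r)) $ i / r ^ \<alpha> i))
           \<longlongrightarrow> (R / norm (v + w))\<^sup>2 * (w \<bullet> C v)) (at_right 0)"
    by (simp add: L_def left_invariant_field_0[OF G])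
  moreover have "(R / norm (v + w))\<^sup>2 * (w \<bullet> C v) < 0"
    using \<open>0 < R\<close> \<open>v + w \<noteq> 0\<close> \<open>w \<noteq> 0\<close> by (simp add: w_def mult_less_0_iff zero_less_mult_iff)
  ultimately have "\<forall>\<^sub>F r in at_right 0.
      r * (\<Sum>i\<in>UNIV. q r $ i * L u (dilation \<alpha> r (q r)) $ i / r ^ \<alpha> i) < 0"
    by (rule order_tendstoD)
  then have "\<forall>\<^sub>F r in at_right 0.
      0 < r \<and> r * (\<Sum>i\<in>UNIV. q r $ i * L u (dilation \<alpha> r (q r)) $ i / r ^ \<alpha> i) < 0"
    by (intro eventually_conj eventually_at_right_less)
  then obtain r where r: "0 < r"
    and "r * (\<Sum>i\<in>UNIV. q r $ i * L u (dilation \<alpha> r (q r)) $ i / r ^ \<alpha> i) < 0"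
    using eventually_happens'[OF trivial_limit_at_right_real] by blast
  define y where "y = dilation \<alpha> r (q r)"
  define S where "S = (\<Sum>i\<in>UNIV. q r $ i * L u y $ i / r ^ \<alpha> i)"
  have S: "S < 0"
    using \<open>r * _ < 0\<close> r by (simp add: S_def y_def mult_less_0_iff)
  have "\<kappa> r > 0"
    using \<open>0 < R\<close> nz by (simp add: \<kappa>_def)
  have norm_q: "norm (q r) = R"
    using \<open>0 < R\<close> nz by (simp add: q_def \<kappa>_def)
  have y_minus: "dilation \<alpha> (1 / r) (- y) = - q r"
    using r by (simp add: y_def dilation_def vec_eq_iff power_one_over)
  define c where "c = r ^ 3 * \<kappa> r"
  have "c > 0"
    using r \<open>\<kappa> r > 0\<close> by (simp add: c_def)
  have "y = c *\<^sub>R u + (r\<^sup>2 * \<kappa> r) *\<^sub>R v + c *\<^sub>R w"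
    using dilation_layers[of \<alpha> u v w r "\<kappa> r * r\<^sup>2" "\<kappa> r" "\<kappa> r"] u v w
    by (simp add: c_def y_def q_def scaleR_add_right power3_eq_cube power2_eq_square mult_ac)
  then have minus_y: "- y = (- c) *\<^sub>R u + (- (r\<^sup>2 * \<kappa> r)) *\<^sub>R v + (- c) *\<^sub>R w"
    by simp
  have dil: "dilation \<alpha> \<mu> (- y) =
      (\<mu> * - c) *\<^sub>R u + (\<mu>\<^sup>2 * - (r\<^sup>2 * \<kappa> r)) *\<^sub>R v + (\<mu> ^ 3 * - c) *\<^sub>R w" for \<mu>
    unfolding minus_y by (rule dilation_layers[OF u v w])
  \<comment> \<open>As \<open>y\<close> is inverse to \<open>- y\<close>, left invariance makes
    \<open>d (\<phi> \<mu>) 0\<close> the distance from \<open>- y\<close> to its dilation.\<close>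
  define \<phi> where "\<phi> \<mu> = mul y (dilation \<alpha> \<mu> (- y))" for \<mu>
  have \<phi>0: "\<phi> 0 = y"
    by (simp add: \<phi>_def dil lie_group_mul_simps[OF G])
  have "((\<lambda>\<mu>. dilation \<alpha> \<mu> (- y)) has_vector_derivative (- c) *\<^sub>R u) (at 0)"
    unfolding dil by (rule has_vector_derivative_cubic_curve)
  moreover have "(mul y has_derivative (\<lambda>a. L a y)) (at (dilation \<alpha> 0 (- y)))"
    using left_invariant_field_has_derivative[OF G, of y] by (simp add: dil L_def)
  ultimately have "(\<phi> has_vector_derivative L ((- c) *\<^sub>R u) y) (at 0)"
    unfolding \<phi>_def by (rule vector_derivative_chain)
  moreover have "L ((- c) *\<^sub>R u) y = (- c) *\<^sub>R L u y"
    unfolding L_def by (rule linear_cmul[OF left_invariant_field_linear[OF G]])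
  ultimately have \<phi>': "(\<phi> has_derivative (\<lambda>t. t *\<^sub>R (- c) *\<^sub>R L u y)) (at 0)"
    by (simp add: has_vector_derivative_def)
  have \<phi>'_nth: "((\<lambda>\<mu>. \<phi> \<mu> $ i) has_real_derivative - c * L u y $ i) (at 0)" for i
    unfolding has_field_derivative_def
    using bounded_linear.has_derivative[OF bounded_linear_vec_nth \<phi>', of i]
    by (rule has_derivative_eq_rhs) (simp add: fun_eq_iff)
  \<comment> \<open>Leaving the ellipsoid means \<open>g \<mu> > R\<^sup>2 = g 0\<close>. In the
    derivative of \<open>g\<close> at \<open>0\<close>, one factor
    \<open>(1 / r) ^ \<alpha> i\<close> turns \<open>y\<close> into \<open>q r\<close> and the other
    rescales the field, which gives \<open>- 2 * c * S > 0\<close>.\<close>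
  define g where "g \<mu> = (norm (dilation \<alpha> (1 / r) (\<phi> \<mu>)))\<^sup>2" for \<mu>
  have "((\<lambda>\<mu>. ((1 / r) ^ \<alpha> i * \<phi> \<mu> $ i)\<^sup>2) has_real_derivative
      - 2 * c * (q r $ i * L u y $ i / r ^ \<alpha> i)) (at 0)" for i
  proof -
    have "2 * ((1 / r) ^ \<alpha> i * y $ i) * ((1 / r) ^ \<alpha> i * (- c * L u y $ i))
        = - 2 * c * (q r $ i * L u y $ i / r ^ \<alpha> i)"
      using r by (simp add: y_def dilation_def power_one_over)
    then show ?thesis
      using DERIV_power[OF DERIV_cmult[OF \<phi>'_nth], of "(1 / r) ^ \<alpha> i" i 2]
      by (simp add: \<phi>0 mult_ac)
  qed
  then have "(g has_real_derivative - 2 * c * S) (at 0)"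
    unfolding g_def norm_dilation_power2 S_def sum_distrib_left by (rule DERIV_sum)
  moreover have "- 2 * c * S > 0"
    using S \<open>c > 0\<close> by (simp add: mult_less_0_iff)
  ultimately have "\<exists>\<delta>>0. \<forall>h>0. h < \<delta> \<longrightarrow> g 0 < g (0 + h)"
    by (rule DERIV_pos_inc_right)
  then obtain \<delta> where "\<delta> > 0" and \<delta>: "\<And>\<mu>. 0 < \<mu> \<Longrightarrow> \<mu> < \<delta> \<Longrightarrow> g 0 < g \<mu>"
    by auto
  have "dilation \<alpha> (1 / r) y = q r"
    using r by (simp add: y_def dilation_dilation)
  then have g0: "g 0 = R\<^sup>2"
    by (simp add: g_def \<phi>0 norm_q)
  show ?thesis
  proof (rule not_BCP_if_dilation_curve_escapes[OF hd r _ \<open>\<delta> > 0\<close>])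
    \<comment> \<open>The Euclidean norm is even, so \<open>- y\<close> lies on the same boundary as
      \<open>y\<close>.\<close>
    show "d (- y) 0 \<le> r"
      by (simp add: homogeneous_distance_le_iff[OF hd assms(7) r] y_minus norm_q)
    show "r < d (- y) (dilation \<alpha> \<mu> (- y))" if "0 < \<mu>" "\<mu> < \<delta>" for \<mu>
    proof -
      have "R < norm (dilation \<alpha> (1 / r) (\<phi> \<mu>))"
        using \<delta>[OF that] unfolding g0 by (simp add: g_def power_less_imp_less_base)
      then have "r < d (\<phi> \<mu>) 0"
        using homogeneous_distance_le_iff[OF hd assms(7) r] by (meson not_le)
      also have "d (\<phi> \<mu>) 0 = d (mul y (- y)) (mul y (dilation \<alpha> \<mu> (- y)))"
        by (simp add: commute \<phi>_def exponential_coordinates_mul_minus[OF G exp])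
      also have "\<dots> = d (- y) (dilation \<alpha> \<mu> (- y))"
        using hd by (simp add: homogeneous_distance_def)
      finally show ?thesis .
    qed
  qed
qed

end
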